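(* Let $\widehat J_g\in\mathbb{R}^{N\times m}$ and $\widehat J_\tau\in\mathbb{R}^{N\times n}$ be the column-normalized response Jacobians of an output $\mathbf O$ with respect to a camera control $g$ and a subject control $\tau$, so that to first order $\delta\mathbf O=\widehat J_g\,\delta g+\widehat J_\tau\,\delta\tau$. Let $\mathcal L_\perp=\lVert \widehat J_g^{\top}\widehat J_\tau\rVert_F^2$, let $P_g$ be the orthogonal projector onto the column space of $\widehat J_g$, and let $L_{s\to c}=\lVert P_g\widehat J_\tau\,\delta\tau\rVert$ be the leakage of a subject edit $\delta\tau$ into the camera-response subspace. Then: (i) if the columns of $\widehat J_g$ are orthonormal, $\lVert P_g\widehat J_\tau\rVert_F=\sqrt{\mathcal L_\perp}$; (ii) in general, $\lVert P_g\widehat J_\tau\rVert_F\le \dfrac{\sqrt{\mathcal L_\perp}}{\sigma_{\min}(\widehat J_g)}$. The symmetric statements hold for $L_{c\to s}=\lVert P_\tau\widehat J_g\,\delta g\rVert$, where $P_\tau$ is the orthogonal projector onto the column space of $\widehat J_\tau$: $\lVert P_\tau\widehat J_g\rVert_F=\sqrt{\mathcal L_\perp}$ if the columns of $\widehat J_\tau$ are orthonormal, and $\lVert P_\tau\widehat J_g\rVert_F\le\sqrt{\mathcal L_\perp}/\sigma_{\min}(\widehat J_\tau)$ in general. Hence $\mathcal L_\perp\to0$ drives the first-order cross-talk ($L_{s\to c}$ and $L_{c\to s}$) to $0$ in both directions.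
   Context: "Column-normalized" means every column has Euclidean norm $1$. $\lVert\cdot\rVert_F$ is the Frobenius norm and $\lVert\cdot\rVert$ the Euclidean norm. For a matrix $A\in\mathbb{R}^{N\times m}$, $\sigma_{\min}(A)=\min_{\lVert v\rVert=1}\lVert Av\rVert$ denotes its smallest singular value; the general bounds are read with right-hand side $+\infty$ (no constraint) when $\sigma_{\min}=0$, i.e. when the matrix does not have full column rank.
   Formalization: The final claim that L_perp→0 drives each leakage to 0 is proved assuming σ_min of the Jacobian projected onto stays above some c>0; without this it fails, e.g. J_g=[e1, cos s e1+sin s e2], J_τ=[e2], s→0+. *)

theory Defs
  imports "HOL-Analysis.Analysis"
begin

text \<open>
  A matrix with \<open>N\<close> rows and \<open>m\<close> columns has type \<open>real ^ 'm ^ 'N\<close>, and the library's \<open>norm\<close> on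
  this type is the Frobenius norm:
\<close>

lemma norm_matrix_eq_frobenius:
  fixes A :: "real ^ 'm ^ 'N"
  shows "norm A = sqrt (\<Sum>i\<in>UNIV. \<Sum>j\<in>UNIV. (A $ i $ j)\<^sup>2)"
  by (simp add: norm_vec_def L2_set_def sum_nonneg)

definition column_normalized :: "real ^ 'm ^ 'N \<Rightarrow> bool" where
  "column_normalized A \<longleftrightarrow> (\<forall>j. norm (column j A) = 1)"

text \<open>
  Indexed by column positions: the set \<^const>\<open>columns\<close> would identify repeated columns.
\<close>

definition orthonormal_columns :: "real ^ 'm ^ 'N \<Rightarrow> bool" where
  "orthonormal_columns A \<longleftrightarrow>
     (\<forall>i j. column i A \<bullet> column j A = (if i = j then 1 else 0))"

text \<open>
  The infimum is a minimum, see \<open>sigma_min_attained\<close> below.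
\<close>

definition sigma_min :: "real ^ 'm ^ 'N \<Rightarrow> real" where
  "sigma_min A = (INF v\<in>{v. norm v = 1}. norm (A *v v))"

definition is_orthogonal_projector :: "real ^ 'N ^ 'N \<Rightarrow> (real ^ 'N) set \<Rightarrow> bool" where
  "is_orthogonal_projector P S \<longleftrightarrow>
     (\<forall>x. P *v x \<in> S \<and> (\<forall>y\<in>S. orthogonal (x - P *v x) y))"

text \<open>
  The column space of \<open>A\<close> is \<open>span (columns A)\<close>; the description is proper by
  \<open>ex1_orthogonal_projector\<close> below.
\<close>

definition column_projector :: "real ^ 'm ^ 'N \<Rightarrow> real ^ 'N ^ 'N" where
  "column_projector A = (THE P. is_orthogonal_projector P (span (columns A)))"

text \<open>
  \<open>Jg\<close> and \<open>Jt\<close> are the two blocks of the total derivative of the output at the operating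
  point \<open>(g, t)\<close>, with the controls measured in the units that make every column a unit vector.
\<close>

definition normalized_response_jacobians ::
  "((real ^ 'm) \<times> (real ^ 'n) \<Rightarrow> real ^ 'N) \<Rightarrow> real ^ 'm \<Rightarrow> real ^ 'n \<Rightarrow>
    real ^ 'm ^ 'N \<Rightarrow> real ^ 'n ^ 'N \<Rightarrow> bool" where
  "normalized_response_jacobians Out g t Jg Jt \<longleftrightarrow>
     (Out has_derivative (\<lambda>(dg, dt). Jg *v dg + Jt *v dt)) (at (g, t)) \<and>
     column_normalized Jg \<and> column_normalized Jt"

definition L_perp :: "real ^ 'm ^ 'N \<Rightarrow> real ^ 'n ^ 'N \<Rightarrow> real" where
  "L_perp Jg Jt = (norm (transpose Jg ** Jt))\<^sup>2"

text \<open>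
  \<open>leakage A B d\<close> is the part of the response \<open>B d\<close> that lies in the column space of \<open>A\<close>:
  \<open>leakage Jg Jt\<close> is the subject-to-camera and \<open>leakage Jt Jg\<close> the camera-to-subject leakage.
\<close>

definition leakage :: "real ^ 'm ^ 'N \<Rightarrow> real ^ 'n ^ 'N \<Rightarrow> real ^ 'n \<Rightarrow> real" where
  "leakage A B d = norm (column_projector A *v (B *v d))"

lemma sigma_min_attained:
  fixes A :: "real ^ 'm ^ 'N"
  obtains v where "norm v = 1" "sigma_min A = norm (A *v v)"
    "\<And>w. norm w = 1 \<Longrightarrow> norm (A *v v) \<le> norm (A *v w)"
proof -
  have "compact (sphere 0 1 :: (real ^ 'm) set)"
    by simp
  moreover have "sphere 0 1 \<noteq> ({} :: (real ^ 'm) set)"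
    by simp
  moreover have "continuous_on (sphere 0 1) (\<lambda>v. norm (A *v v))"
    by (intro continuous_on_norm linear_continuous_on matrix_vector_mul_bounded_linear)
  ultimately obtain v where v: "v \<in> sphere 0 1"
    "\<forall>w\<in>sphere 0 1. norm (A *v v) \<le> norm (A *v w)"
    using continuous_attains_inf by blast
  have "sigma_min A = norm (A *v v)"
    unfolding sigma_min_def by (rule cInf_eq_minimum) (use v in auto)
  with v show thesis
    by (intro that[of v]) auto
qed

lemma sigma_min_orthonormal:
  fixes A :: "real ^ 'm ^ 'N"
  assumes "orthonormal_columns A"
  shows "sigma_min A = 1"
proof -
  have "transpose A ** A = mat 1"
    using assms
    by (simp add: vec_eq_iff orthonormal_columns_def mat_def matrix_matrix_mult_def
        transpose_def column_def inner_vec_def)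
  then have "(A *v v) \<bullet> (A *v v) = v \<bullet> v" for v
    by (metis dot_lmul_matrix matrix_vector_mul_assoc matrix_vector_mul_lid
        vector_transpose_matrix inner_commute transpose_matrix_vector)
  then have "norm (A *v v) = norm v" for v
    by (simp add: norm_eq)
  then show ?thesis
    using sigma_min_attained[of A] by metis
qed

lemma ex1_orthogonal_projector:
  fixes S :: "(real ^ 'N) set"
  assumes S: "subspace S"
  shows "\<exists>!P. is_orthogonal_projector P S"
proof -
  have uniq: "p = q"
    if "p \<in> S" "q \<in> S" "\<forall>y\<in>S. orthogonal (x - p) y" "\<forall>y\<in>S. orthogonal (x - q) y"
    for p q x :: "real ^ 'N"
  proof -
    have "p - q \<in> S"
      using S that by (simp add: subspace_diff)
    then have "(x - q) \<bullet> (p - q) - (x - p) \<bullet> (p - q) = 0"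
      using that by (simp add: orthogonal_def)
    then have "(p - q) \<bullet> (p - q) = 0"
      by (simp add: inner_diff_left)
    then show ?thesis
      by simp
  qed
  have "\<exists>p\<in>S. \<forall>y\<in>S. orthogonal (x - p) y" for x
    using orthogonal_subspace_decomp_exists[of S x] S
    by (metis add_diff_cancel_left' span_eq_iff)
  then obtain f where f: "\<And>x. f x \<in> S" "\<And>x y. y \<in> S \<Longrightarrow> orthogonal (x - f x) y"
    by metis
  have "linear f"
  proof (rule linearI)
    fix x y
    show "f (x + y) = f x + f y"
    proof (rule uniq[of _ _ "x + y"])
      show "\<forall>z\<in>S. orthogonal (x + y - (f x + f y)) z"
        using f(2)[of _ x] f(2)[of _ y]
        by (auto simp: orthogonal_def inner_diff_left inner_add_left)
    qed (use f S in \<open>auto simp: subspace_add\<close>)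
  next
    fix c :: real and x
    show "f (c *\<^sub>R x) = c *\<^sub>R f x"
    proof (rule uniq[of _ _ "c *\<^sub>R x"])
      show "\<forall>z\<in>S. orthogonal (c *\<^sub>R x - c *\<^sub>R f x) z"
        using f(2)[of _ x] by (auto simp: orthogonal_def inner_diff_left)
    qed (use f S in \<open>auto simp: subspace_scale\<close>)
  qed
  then have mf: "matrix f *v x = f x" for x
    by (simp add: matrix_works linear_matrix_vector_mul_eq)
  show ?thesis
  proof (rule ex1I[of _ "matrix f"])
    show "is_orthogonal_projector (matrix f) S"
      using f by (simp add: is_orthogonal_projector_def mf)
    show "P = matrix f" if "is_orthogonal_projector P S" for P
      unfolding matrix_eq
    proof
      fix x
      show "P *v x = matrix f *v x"
        by (rule uniq[of _ _ x]) (use that f in \<open>auto simp: is_orthogonal_projector_def mf\<close>)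
    qed
  qed
qed

lemma column_projector:
  "is_orthogonal_projector (column_projector A) (span (columns A))"
  unfolding column_projector_def
  by (rule theI') (simp add: ex1_orthogonal_projector)

end

theory Submission
  imports Defs
begin

text \<open>
  If \<open>p\<close> is the projection of \<open>y\<close> onto the column space of \<open>A\<close>, then \<open>A\<^sup>T y = A\<^sup>T p\<close>. Writing
  \<open>p = A c\<close> gives \<open>\<parallel>p\<parallel>\<^sup>2 = A\<^sup>T p \<bullet> c \<le> \<parallel>A\<^sup>T p\<parallel> \<parallel>c\<parallel>\<close>, and \<open>\<sigma> \<parallel>c\<parallel> \<le> \<parallel>p\<parallel>\<close> turns this into
  \<open>\<sigma> \<parallel>p\<parallel> \<le> \<parallel>A\<^sup>T y\<parallel>\<close>, where \<open>\<sigma>\<close> is the smallest singular value of \<open>A\<close>. If the columns of \<open>A\<close>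
  are orthonormal, \<open>A\<close> is an isometry, so its transpose is a contraction and equality holds.
  Applied to each column of \<open>B\<close>, this compares the Frobenius norms of \<open>P B\<close> and \<open>A\<^sup>T B\<close>.
\<close>

text \<open>Cauchy-Schwarz in each row. It lets a Frobenius bound on a projected Jacobian control
  the leakage of a single edit.\<close>

lemma norm_matrix_vector_mult_le:
  fixes A :: "real ^ 'm ^ 'N"
  shows "norm (A *v x) \<le> norm A * norm x"
proof -
  have "norm (A *v x) \<le> L2_set (\<lambda>i. norm (A $ i) * norm x) UNIV"
    unfolding norm_vec_def[of "A *v x"]
    by (rule L2_set_mono) (simp_all add: matrix_vector_mul_component Cauchy_Schwarz_ineq2)
  also have "\<dots> = norm A * norm x"
    by (simp add: norm_vec_def[of A] L2_set_left_distrib)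
  finally show ?thesis .
qed

lemma norm_transpose:
  fixes A :: "real ^ 'm ^ 'N"
  shows "norm (transpose A) = norm A"
  unfolding norm_matrix_eq_frobenius transpose_def by simp (rule sum.swap)

text \<open>The library norm runs over rows. Regrouping by columns reduces Frobenius estimates for
  \<open>A ** B\<close> to vector estimates, one for each column of \<open>B\<close>.\<close>

lemma norm_matrix_eq_L2_set_columns:
  fixes A :: "real ^ 'm ^ 'N"
  shows "norm A = L2_set (\<lambda>j. norm (column j A)) UNIV"
  using norm_transpose[of A] row_transpose[of _ A]
  by (simp add: norm_vec_def[of "transpose A"] row_def)

lemma column_matrix_mult:
  fixes A :: "real ^ 'm ^ 'N"
  shows "column j (A ** B) = A *v column j B"
  by (simp add: vec_eq_iff column_def matrix_matrix_mult_def matrix_vector_mult_def)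

text \<open>The two cross products are transposes of each other and so have equal Frobenius norm.
  This yields the statements with camera and subject exchanged.\<close>

lemma L_perp_commute: "L_perp A B = L_perp B A"
  unfolding L_perp_def
  by (metis matrix_transpose_mul norm_transpose transpose_transpose)

lemma sqrt_L_perp: "sqrt (L_perp A B) = norm (transpose A ** B)"
  by (simp add: L_perp_def)

lemma sigma_min_nonneg: "0 \<le> sigma_min A"
  by (metis sigma_min_attained norm_ge_zero)

lemma sigma_min_mult_norm_le:
  fixes A :: "real ^ 'm ^ 'N"
  shows "sigma_min A * norm v \<le> norm (A *v v)"
proof (cases "v = 0")
  case False
  obtain u where "sigma_min A = norm (A *v u)"
    and "\<And>w. norm w = 1 \<Longrightarrow> norm (A *v u) \<le> norm (A *v w)"
    using sigma_min_attained[of A] by metis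
  then have "sigma_min A \<le> norm (A *v (v /\<^sub>R norm v))"
    using False by simp
  also have "\<dots> = norm (A *v v) / norm v"
    by (simp add: matrix_vector_mult_scaleR divide_inverse_commute)
  finally show ?thesis
    using False by (simp add: pos_le_divide_eq)
qed simp

lemma inner_matrix_vector_mult:
  fixes A :: "real ^ 'm ^ 'N"
  shows "x \<bullet> (A *v y) = (transpose A *v x) \<bullet> y"
  by (simp add: dot_lmul_matrix)

text \<open>The residual of the projection is orthogonal to every column of \<open>A\<close>, so the
  transpose of \<open>A\<close> annihilates it.\<close>

lemma transpose_mult_column_projector:
  fixes A :: "real ^ 'm ^ 'N"
  shows "transpose A *v (column_projector A *v y) = transpose A *v y"
proof -
  have "column j A \<bullet> (y - column_projector A *v y) = 0" for j
    using column_projector[of A] span_base[of "column j A" "columns A"]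
    by (auto simp: is_orthogonal_projector_def orthogonal_def columns_def inner_commute)
  then have "transpose A *v (y - column_projector A *v y) = 0"
    by (simp add: vec_eq_iff matrix_vector_mul_component transpose_def column_def)
  then show ?thesis
    by (simp add: matrix_vector_mult_diff_distrib)
qed

lemma column_projector_in_range:
  fixes A :: "real ^ 'm ^ 'N"
  obtains c where "column_projector A *v y = A *v c"
proof -
  have "column_projector A *v y \<in> span (columns A)"
    using column_projector[of A] by (simp add: is_orthogonal_projector_def)
  moreover have "span (columns A) \<subseteq> range ((*v) A)"
  proof (rule span_minimal)
    show "columns A \<subseteq> range ((*v) A)"
      using matrix_vector_mult_basis[of A] by (auto simp: columns_def) (metis rangeI)
    show "subspace (range ((*v) A))"
      by (simp add: linear_subspace_image subspace_UNIV)
  qed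
  ultimately show ?thesis
    using that by blast
qed

lemma sigma_min_mult_norm_projection_le:
  fixes A :: "real ^ 'm ^ 'N"
  shows "sigma_min A * norm (column_projector A *v y) \<le> norm (transpose A *v y)"
proof -
  obtain c where c: "column_projector A *v y = A *v c"
    by (rule column_projector_in_range)
  let ?p = "A *v c"
  have "norm ?p * norm ?p = (transpose A *v ?p) \<bullet> c"
    unfolding inner_matrix_vector_mult[symmetric] norm_eq_sqrt_inner by simp
  also have "\<dots> = (transpose A *v y) \<bullet> c"
    using transpose_mult_column_projector[of A y] unfolding c by (rule arg_cong)
  also have "\<dots> \<le> norm (transpose A *v y) * norm c"
    by (rule norm_cauchy_schwarz)
  finally have "sigma_min A * (norm ?p * norm ?p)
      \<le> norm (transpose A *v y) * (sigma_min A * norm c)"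
    using mult_left_mono[OF _ sigma_min_nonneg[of A]] by (metis mult.left_commute)
  also have "\<dots> \<le> norm (transpose A *v y) * norm ?p"
    by (intro mult_left_mono sigma_min_mult_norm_le) simp
  finally have "(sigma_min A * norm ?p) * norm ?p \<le> norm (transpose A *v y) * norm ?p"
    by (simp add: mult.assoc)
  \<comment> \<open>Cancel one factor \<open>norm ?p\<close>; if it vanishes, the left-hand side of
    the goal is 0.\<close>
  then show ?thesis
    by (cases "?p = 0") (simp_all add: c)
qed

lemma norm_mult_orthonormal_columns:
  assumes "orthonormal_columns A"
  shows "norm (A *v v) = norm v"
proof -
  have "transpose A ** A = mat 1"
    using assms
    by (simp add: vec_eq_iff orthonormal_columns_def mat_def matrix_matrix_mult_def
        transpose_def column_def inner_vec_def)
  then show ?thesis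
    by (simp add: norm_eq inner_matrix_vector_mult matrix_vector_mul_assoc)
qed

lemma norm_transpose_mult_orthonormal_columns_le:
  assumes "orthonormal_columns A"
  shows "norm (transpose A *v y) \<le> norm y"
proof -
  let ?z = "transpose A *v y"
  have "norm ?z * norm ?z = y \<bullet> (A *v ?z)"
    by (simp add: inner_matrix_vector_mult flip: power2_eq_square power2_norm_eq_inner)
  also have "\<dots> \<le> norm y * norm ?z"
    using norm_cauchy_schwarz[of y "A *v ?z"] norm_mult_orthonormal_columns[OF assms] by simp
  finally show ?thesis
    by (cases "?z = 0") auto
qed

lemma norm_projection_orthonormal_columns:
  assumes "orthonormal_columns A"
  shows "norm (column_projector A *v y) = norm (transpose A *v y)"
proof (rule antisym)
  show "norm (column_projector A *v y) \<le> norm (transpose A *v y)"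
    using sigma_min_mult_norm_projection_le[of A y] sigma_min_orthonormal[OF assms] by simp
  show "norm (transpose A *v y) \<le> norm (column_projector A *v y)"
    using norm_transpose_mult_orthonormal_columns_le[OF assms, of "column_projector A *v y"]
    unfolding transpose_mult_column_projector .
qed

theorem norm_projector_mult_orthonormal:
  assumes "orthonormal_columns A"
  shows "norm (column_projector A ** B) = sqrt (L_perp A B)"
  by (simp add: sqrt_L_perp norm_matrix_eq_L2_set_columns column_matrix_mult
      norm_projection_orthonormal_columns[OF assms])

text \<open>The form without division also covers \<open>sigma_min A = 0\<close>.\<close>

theorem sigma_min_mult_norm_projector_mult_le:
  "sigma_min A * norm (column_projector A ** B) \<le> sqrt (L_perp A B)"
  unfolding sqrt_L_perp norm_matrix_eq_L2_set_columns column_matrix_mult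
    L2_set_right_distrib[OF sigma_min_nonneg]
  by (intro L2_set_mono sigma_min_mult_norm_projection_le mult_nonneg_nonneg
      sigma_min_nonneg norm_ge_zero)

text \<open>Division by zero is 0 in HOL, so the hypothesis expresses the convention that the bound
  is infinite when \<open>sigma_min A = 0\<close>.\<close>

corollary norm_projector_mult_le:
  assumes "sigma_min A \<noteq> 0"
  shows "norm (column_projector A ** B) \<le> sqrt (L_perp A B) / sigma_min A"
  using sigma_min_mult_norm_projector_mult_le[of A B] assms sigma_min_nonneg[of A]
  by (simp add: pos_le_divide_eq mult.commute)

lemma leakage_le: "leakage A B d \<le> norm (column_projector A ** B) * norm d"
  unfolding leakage_def matrix_vector_mul_assoc by (rule norm_matrix_vector_mult_le)

text \<open>
  The lower bound on \<open>sigma_min\<close> has to be uniform: two nearly parallel unit columns of \<open>A\<close> can span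
  a unit column of \<open>B\<close> that is nearly orthogonal to both of them.
\<close>

theorem leakage_tendsto_zero:
  assumes L: "((\<lambda>k. L_perp (As k) (Bs k)) \<longlongrightarrow> 0) F"
    and c: "0 < c" "\<forall>\<^sub>F k in F. c \<le> sigma_min (As k)"
  shows "((\<lambda>k. leakage (As k) (Bs k) d) \<longlongrightarrow> 0) F"
proof (rule tendsto_sandwich)
  show "\<forall>\<^sub>F k in F. 0 \<le> leakage (As k) (Bs k) d"
    by (simp add: leakage_def)
  show "\<forall>\<^sub>F k in F. leakage (As k) (Bs k) d \<le> sqrt (L_perp (As k) (Bs k)) / c * norm d"
    using c(2)
  proof eventually_elim
    case (elim k)
    \<comment> \<open>Replacing the varying singular value by \<open>c\<close> makes the upper bound
      a fixed multiple of \<open>sqrt (L_perp (As k) (Bs k))\<close>.\<close>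
    have "c * norm (column_projector (As k) ** Bs k)
        \<le> sigma_min (As k) * norm (column_projector (As k) ** Bs k)"
      using elim by (simp add: mult_right_mono)
    also have "\<dots> \<le> sqrt (L_perp (As k) (Bs k))"
      by (rule sigma_min_mult_norm_projector_mult_le)
    finally have "norm (column_projector (As k) ** Bs k) \<le> sqrt (L_perp (As k) (Bs k)) / c"
      using c(1) by (simp add: pos_le_divide_eq mult.commute)
    then show ?case
      by (intro order_trans[OF leakage_le] mult_right_mono) simp_all
  qed
  show "((\<lambda>k. sqrt (L_perp (As k) (Bs k)) / c * norm d) \<longlongrightarrow> 0) F"
    using tendsto_mult_left_zero[OF tendsto_divide_zero[OF tendsto_real_sqrt[OF L, simplified]]]
    by simp
qed simp

theorem theorem3:
  fixes Out :: "(real ^ 'm) \<times> (real ^ 'n) \<Rightarrow> real ^ 'N"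
    and g :: "real ^ 'm" and t :: "real ^ 'n"
    and Jg :: "real ^ 'm ^ 'N" and Jt :: "real ^ 'n ^ 'N"
  assumes "normalized_response_jacobians Out g t Jg Jt"
  shows
    "(orthonormal_columns Jg \<longrightarrow> norm (column_projector Jg ** Jt) = sqrt (L_perp Jg Jt)) \<and>
     (sigma_min Jg \<noteq> 0 \<longrightarrow>
        norm (column_projector Jg ** Jt) \<le> sqrt (L_perp Jg Jt) / sigma_min Jg) \<and>
     (orthonormal_columns Jt \<longrightarrow> norm (column_projector Jt ** Jg) = sqrt (L_perp Jg Jt)) \<and>
     (sigma_min Jt \<noteq> 0 \<longrightarrow>
        norm (column_projector Jt ** Jg) \<le> sqrt (L_perp Jg Jt) / sigma_min Jt) \<and>
     (\<forall>(F :: 'k filter) (Outs :: 'k \<Rightarrow> (real ^ 'm) \<times> (real ^ 'n) \<Rightarrow> real ^ 'N) gs ts Jgs Jts.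
        (\<forall>k. normalized_response_jacobians (Outs k) (gs k) (ts k) (Jgs k) (Jts k)) \<and>
        ((\<lambda>k. L_perp (Jgs k) (Jts k)) \<longlongrightarrow> 0) F \<longrightarrow>
          ((\<exists>c>0. \<forall>\<^sub>F k in F. c \<le> sigma_min (Jgs k)) \<longrightarrow>
             (\<forall>dt. ((\<lambda>k. leakage (Jgs k) (Jts k) dt) \<longlongrightarrow> 0) F)) \<and>
          ((\<exists>c>0. \<forall>\<^sub>F k in F. c \<le> sigma_min (Jts k)) \<longrightarrow>
             (\<forall>dg. ((\<lambda>k. leakage (Jts k) (Jgs k) dg) \<longlongrightarrow> 0) F)))"
proof (intro conjI allI impI)
  show "norm (column_projector Jg ** Jt) = sqrt (L_perp Jg Jt)" if "orthonormal_columns Jg"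
    using that by (rule norm_projector_mult_orthonormal)
  show "norm (column_projector Jg ** Jt) \<le> sqrt (L_perp Jg Jt) / sigma_min Jg"
    if "sigma_min Jg \<noteq> 0"
    using that by (rule norm_projector_mult_le)
  show "norm (column_projector Jt ** Jg) = sqrt (L_perp Jg Jt)" if "orthonormal_columns Jt"
    unfolding L_perp_commute[of Jg] using that by (rule norm_projector_mult_orthonormal)
  show "norm (column_projector Jt ** Jg) \<le> sqrt (L_perp Jg Jt) / sigma_min Jt"
    if "sigma_min Jt \<noteq> 0"
    unfolding L_perp_commute[of Jg] using that by (rule norm_projector_mult_le)
next
  fix F :: "'k filter" and Outs :: "'k \<Rightarrow> (real ^ 'm) \<times> (real ^ 'n) \<Rightarrow> real ^ 'N"
    and gs ts Jgs Jts
  assume "(\<forall>k. normalized_response_jacobians (Outs k) (gs k) (ts k) (Jgs k) (Jts k)) \<and>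
    ((\<lambda>k. L_perp (Jgs k) (Jts k)) \<longlongrightarrow> 0) F"
  then have L: "((\<lambda>k. L_perp (Jgs k) (Jts k)) \<longlongrightarrow> 0) F" ..
  show "((\<lambda>k. leakage (Jgs k) (Jts k) dt) \<longlongrightarrow> 0) F"
    if "\<exists>c>0. \<forall>\<^sub>F k in F. c \<le> sigma_min (Jgs k)" for dt
    using that leakage_tendsto_zero[OF L] by blast
  \<comment> \<open>Symmetry of \<open>L_perp\<close> turns the same limit into the hypothesis for
    the camera-to-subject direction.\<close>
  have L': "((\<lambda>k. L_perp (Jts k) (Jgs k)) \<longlongrightarrow> 0) F"
    using L unfolding L_perp_commute[of "Jgs _"] .
  show "((\<lambda>k. leakage (Jts k) (Jgs k) dg) \<longlongrightarrow> 0) F"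
    if "\<exists>c>0. \<forall>\<^sub>F k in F. c \<le> sigma_min (Jts k)" for dg
    using that leakage_tendsto_zero[OF L'] by blast
qed

end
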